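(* Let $\varphi$ be an Orlicz $N$-function satisfying the $Q$-condition, let $(X_t)_{t\in T}$ be a $\varphi$-sub-Gaussian process with metric $d(s,t)=\tau_\varphi(X_t-X_s)$ on $T$, let $1\le p<\infty$, and let $r\ge16$ be an integer. Then the functional $H\mapsto\gamma_{\varphi,p}(H,d)$ on subsets of $T$ satisfies the generalized growth condition with parameters $r$ and $c^*=1/8$. Likewise, the functional $H\mapsto\tilde\gamma_{\varphi,p}(H,d)$ satisfies the generalized growth condition with parameters $r$ and $c^*=1/8$.
   Context: An Orlicz $N$-function is a continuous, even, convex function $\varphi:\mathbb{R}\to\mathbb{R}$ with $\varphi(0)=0$, increasing on $x>0$, with $\varphi(x)/x\to0$ as $x\to0$ and $\varphi(x)/x\to\infty$ as $x\to\infty$. It satisfies the $Q$-condition if $\liminf_{x\to0}\varphi(x)/x^2=c$ for some constant $c>0$. Its convex conjugate is $\varphi^*(x)=\sup_{y\in\mathbb{R}}(xy-\varphi(y))$, and $\varphi^{*(-1)}$ denotes the inverse function of $\varphi^*$ on $[0,\infty)$. A mean-zero random variable $\xi$ is $\varphi$-sub-Gaussian if there is $a\ge0$ with $\mathsf{E}\exp(\lambda\xi)\le\exp(\varphi(a\lambda))$ for all $\lambda\in\mathbb{R}$; $\tau_\varphi(\xi)$ is the infimum of such $a$. A process $(X_t)_{t\in T}$ is $\varphi$-sub-Gaussian if every $X_t$ is; $d(s,t)=\tau_\varphi(X_t-X_s)$ is taken to be a metric on $T$. $\Delta(S)$ is the $d$-diameter of $S$ and $B(t,\rho)$ is the closed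 ball. For $1\le p<\infty$, $k_p=\lfloor\log p/\log2\rfloor=\lfloor\log_2 p\rfloor$. For $H\subset T$ nonempty, an admissible sequence of $H$ is an increasing (i.e. successively refining) sequence $(\mathcal{A}_n)_{n\ge0}$ of partitions of $H$ with $\operatorname{card}(\mathcal{A}_0)=1$ and $\operatorname{card}(\mathcal{A}_n)\le2^{2^n}$ for $n\ge1$; $A_n(t)$ is the element of $\mathcal{A}_n$ containing $t$. Define $$\gamma_{\varphi,p}(H,d)=\inf\ \sup_{t\in H}\sum_{n\ge k_p}\varphi^{*(-1)}(2^n)\Delta(A_n(t)),$$ the infimum over all admissible sequences of $H$, and $$\tilde\gamma_{\varphi,p}(H,d)=\inf\ \sup_{t\in H}\sum_{n\ge k_p}\varphi^{*(-1)}(2^n)\,d(t,T_n),$$ the infimum over all sequences of subsets $T_n\subset T$ with $\operatorname{card}(T_n)\le2^{2^n}$. Values in $[0,\infty]$ are allowed. A functional on subsets of $T$ is a map $F$ with $F(H)\ge0$ (value $+\infty$ allowed) and $F(H')\ge F(H)$ whenever $H\subset H'\subset T$. Given $a>0$ and an integer $r\ge8$, nonempty subsets $H_1,\dots,H_m$ of $T$ are $(a,r)$-separated if there are points $t_1,\dots,t_m\in T$ with $a\le d(t_\ell,t_{\ell'})\le2ar$ for all $\ell\ne\ell'$ and $H_\ell\subset B(t_\ell,2a/r)$ for all $\ell\le m$. A functional $F$ satisfies the generalized growth condition with parameters $r\ge8$ and $c^*>0$ if for every integer $n\ge1+\lfloor\log_2p\rfloor$, every $a>0$, and every $(a,r)$-separated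 collection $H_1,\dots,H_m$ of subsets of $T$ with $m=2^{2^n}$, $$F\Big(\bigcup_{\ell\le m}H_\ell\Big)\ge c^*a\,\varphi^{*(-1)}(2^n)+\min_{\ell\le m}F(H_\ell).$$ *)

theory Defs
  imports "HOL-Probability.Probability"
begin

definition orlicz_N_function :: "(real \<Rightarrow> real) \<Rightarrow> bool" where
  "orlicz_N_function \<phi> \<longleftrightarrow>
     continuous_on UNIV \<phi> \<and> (\<forall>x. \<phi> (- x) = \<phi> x) \<and> convex_on UNIV \<phi> \<and> \<phi> 0 = 0 \<and>
     strict_mono_on {0<..} \<phi> \<and>
     ((\<lambda>x. \<phi> x / x) \<longlongrightarrow> 0) (at 0) \<and>
     filterlim (\<lambda>x. \<phi> x / x) at_top at_top"

definition Q_condition :: "(real \<Rightarrow> real) \<Rightarrow> bool" where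
  "Q_condition \<phi> \<longleftrightarrow> (\<exists>c::real. 0 < c \<and> Liminf (at 0) (\<lambda>x. ereal (\<phi> x / x\<^sup>2)) = ereal c)"

text \<open>The supremum in the conjugate is a real supremum: an N-function grows superlinearly, so the
  set is bounded above. The conjugate is then a bijection of \<open>[0,\<infinity>)\<close> onto itself, so that its
  inverse there is meaningful at every nonnegative argument.\<close>

definition convex_conjugate :: "(real \<Rightarrow> real) \<Rightarrow> real \<Rightarrow> real" where
  "convex_conjugate \<phi> x = (SUP y. x * y - \<phi> y)"

definition conjugate_inv :: "(real \<Rightarrow> real) \<Rightarrow> real \<Rightarrow> real" where
  "conjugate_inv \<phi> = the_inv_into {0..} (convex_conjugate \<phi>)"

text \<open>Exponential moments are nonnegative integrals, which take the value \<open>\<infinity>\<close> when the exponential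
  is not integrable; the Bochner integral would be \<open>0\<close> there.\<close>

definition sub_gaussian_bound :: "'w measure \<Rightarrow> (real \<Rightarrow> real) \<Rightarrow> ('w \<Rightarrow> real) \<Rightarrow> real \<Rightarrow> bool" where
  "sub_gaussian_bound M \<phi> \<xi> a \<longleftrightarrow>
     0 \<le> a \<and> (\<forall>l. (\<integral>\<^sup>+ w. ennreal (exp (l * \<xi> w)) \<partial>M) \<le> ennreal (exp (\<phi> (a * l))))"

definition sub_gaussian :: "'w measure \<Rightarrow> (real \<Rightarrow> real) \<Rightarrow> ('w \<Rightarrow> real) \<Rightarrow> bool" where
  "sub_gaussian M \<phi> \<xi> \<longleftrightarrow>
     integrable M \<xi> \<and> (\<integral>w. \<xi> w \<partial>M) = 0 \<and> (\<exists>a. sub_gaussian_bound M \<phi> \<xi> a)"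

definition sub_gaussian_norm :: "'w measure \<Rightarrow> (real \<Rightarrow> real) \<Rightarrow> ('w \<Rightarrow> real) \<Rightarrow> real" where
  "sub_gaussian_norm M \<phi> \<xi> = Inf {a. sub_gaussian_bound M \<phi> \<xi> a}"

definition sub_gaussian_process ::
  "'w measure \<Rightarrow> (real \<Rightarrow> real) \<Rightarrow> 't set \<Rightarrow> ('t \<Rightarrow> 'w \<Rightarrow> real) \<Rightarrow> bool" where
  "sub_gaussian_process M \<phi> T X \<longleftrightarrow> (\<forall>t\<in>T. sub_gaussian M \<phi> (X t))"

definition ext_diameter :: "('t \<Rightarrow> 't \<Rightarrow> real) \<Rightarrow> 't set \<Rightarrow> ennreal" where
  "ext_diameter d S = (SUP s\<in>S. SUP t\<in>S. ennreal (d s t))"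

definition ext_dist_to :: "('t \<Rightarrow> 't \<Rightarrow> real) \<Rightarrow> 't \<Rightarrow> 't set \<Rightarrow> ennreal" where
  "ext_dist_to d t S = (INF s\<in>S. ennreal (d t s))"

definition k_index :: "real \<Rightarrow> nat" where
  "k_index p = nat \<lfloor>log 2 p\<rfloor>"

definition admissible_sequence :: "'t set \<Rightarrow> (nat \<Rightarrow> 't set set) \<Rightarrow> bool" where
  "admissible_sequence H A \<longleftrightarrow>
     (\<forall>n. partition_on H (A n)) \<and> (\<forall>n. refines H (A (Suc n)) (A n)) \<and>
     card (A 0) = 1 \<and> (\<forall>n\<ge>1. finite (A n) \<and> card (A n) \<le> 2 ^ 2 ^ n)"

definition block :: "'t set set \<Rightarrow> 't \<Rightarrow> 't set" where
  "block P t = (THE B. B \<in> P \<and> t \<in> B)"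

text \<open>The empty set has no admissible sequence, as its only partition is empty; \<open>gamma_fun\<close> is
  \<open>0\<close> there, so that it is monotone on all subsets.\<close>

definition gamma_fun ::
  "(real \<Rightarrow> real) \<Rightarrow> real \<Rightarrow> ('t \<Rightarrow> 't \<Rightarrow> real) \<Rightarrow> 't set \<Rightarrow> ennreal" where
  "gamma_fun \<phi> p d H =
     (if H = {} then 0
      else INF A\<in>{A. admissible_sequence H A}. SUP t\<in>H.
             (\<Sum>n. ennreal (conjugate_inv \<phi> (2 ^ (n + k_index p))) *
                   ext_diameter d (block (A (n + k_index p)) t)))"

definition gamma_tilde ::
  "(real \<Rightarrow> real) \<Rightarrow> real \<Rightarrow> 't set \<Rightarrow> ('t \<Rightarrow> 't \<Rightarrow> real) \<Rightarrow> 't set \<Rightarrow> ennreal" where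
  "gamma_tilde \<phi> p T d H =
     (INF S\<in>{S :: nat \<Rightarrow> 't set. \<forall>n. S n \<subseteq> T \<and> finite (S n) \<and> card (S n) \<le> 2 ^ 2 ^ n}. SUP t\<in>H.
        (\<Sum>n. ennreal (conjugate_inv \<phi> (2 ^ (n + k_index p))) * ext_dist_to d t (S (n + k_index p))))"

definition set_functional :: "'t set \<Rightarrow> ('t set \<Rightarrow> ennreal) \<Rightarrow> bool" where
  "set_functional T F \<longleftrightarrow> (\<forall>H H'. H \<subseteq> H' \<and> H' \<subseteq> T \<longrightarrow> F H \<le> F H')"

definition separated_sets ::
  "'t set \<Rightarrow> ('t \<Rightarrow> 't \<Rightarrow> real) \<Rightarrow> real \<Rightarrow> nat \<Rightarrow> nat \<Rightarrow> (nat \<Rightarrow> 't set) \<Rightarrow> bool" where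
  "separated_sets T d a r m H \<longleftrightarrow>
     (\<forall>l\<in>{1..m}. H l \<noteq> {} \<and> H l \<subseteq> T) \<and>
     (\<exists>t. (\<forall>l\<in>{1..m}. t l \<in> T) \<and>
          (\<forall>l\<in>{1..m}. \<forall>l'\<in>{1..m}. l \<noteq> l' \<longrightarrow> a \<le> d (t l) (t l') \<and> d (t l) (t l') \<le> 2 * a * real r) \<and>
          (\<forall>l\<in>{1..m}. H l \<subseteq> Metric_space.mcball T d (t l) (2 * a / real r)))"

definition generalized_growth_condition ::
  "(real \<Rightarrow> real) \<Rightarrow> real \<Rightarrow> 't set \<Rightarrow> ('t \<Rightarrow> 't \<Rightarrow> real) \<Rightarrow> nat \<Rightarrow> real \<Rightarrow> ('t set \<Rightarrow> ennreal) \<Rightarrow> bool"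
  where
  "generalized_growth_condition \<phi> p T d r c F \<longleftrightarrow>
     set_functional T F \<and> 8 \<le> r \<and> 0 < c \<and>
     (\<forall>n a H. 1 + k_index p \<le> n \<and> 0 < a \<and> separated_sets T d a r (2 ^ 2 ^ n) H \<longrightarrow>
        F (\<Union>l\<in>{1..2 ^ 2 ^ n}. H l) \<ge>
          ennreal (c * a * conjugate_inv \<phi> (2 ^ n)) + Min ((\<lambda>l. F (H l)) ` {1..2 ^ 2 ^ n}))"

end

theory Submission
  imports Defs
begin

text \<open>
  Write \<open>c j\<close> for the inverse of the conjugate of \<open>\<phi>\<close> at \<open>2 ^ j\<close>. The conjugate is an increasing
  convex bijection of the half-line that vanishes at \<open>0\<close>, so its inverse is concave there, and hence
  \<open>c n \<le> 2 * c (n - 1)\<close> (\<open>conjugate_inv_double\<close>). With this, a loss of one level in the sums costs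
  a factor \<open>2\<close> at most, and the rest is a pigeonhole argument in the metric space.

  Let \<open>H 1, \<dots>, H m\<close> be \<open>(a, r)\<close>-separated with \<open>m = 2 ^ 2 ^ n\<close> and \<open>r \<ge> 16\<close>. Each \<open>H l\<close> lies in
  the ball of radius \<open>a / 8\<close> about its centre \<open>t l\<close>, and the centres are \<open>a\<close> apart. A partition of
  the union, or a set of points, that is available at level \<open>n - 1\<close> has fewer than \<open>m\<close> elements.
  So it cannot resolve all the pieces at once, and some index \<open>l\<close> is left over.

  For \<open>gamma_fun\<close>, no block of the level \<open>n - 1\<close> partition that meets the leftover \<open>H l\<close> is
  contained in \<open>H l\<close> (\<open>separated_pieces_unresolved\<close>): it also meets another piece, which forces
  its diameter to be at least \<open>3 * a / 4\<close>. The trace of this block on \<open>H l\<close> has diameter at most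
  \<open>a / 4\<close>. For \<open>gamma_tilde\<close>, the leftover centre \<open>t l\<close> is at distance at least \<open>a / 2\<close> from all
  approximating points of level \<open>n - 1\<close> (\<open>separated_centres_unapproximated\<close>), so that points of
  \<open>H l\<close> are at distance at least \<open>3 * a / 8\<close> from them, but at most \<open>a / 8\<close> from \<open>t l\<close>.
  Therefore, if the partitions are restricted to \<open>H l\<close>, respectively if the approximating set of
  level \<open>n - 1\<close> is replaced by the single point \<open>t l\<close>, one gets a competitor for \<open>H l\<close> in which
  the term of level \<open>n - 1\<close> is smaller by at least \<open>c (n - 1) * a / 4 \<ge> c n * a / 8\<close>, uniformly
  in the point of \<open>H l\<close>, while no other term is larger (\<open>SUP_weighted_suminf_add_le\<close>). Level
  \<open>n - 1\<close> does occur in the sum, because \<open>n \<ge> 1 + k_index p\<close>. The index \<open>l\<close> depends on the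
  competitor for the union, which is why the bound involves the minimum over all pieces.
\<close>

section \<open>The inverse of the convex conjugate\<close>

lemma orlicz_N_function_nonneg:
  assumes "orlicz_N_function \<phi>"
  shows "0 \<le> \<phi> y"
proof -
  from assms have "convex_on UNIV \<phi>" "\<phi> (- y) = \<phi> y" "\<phi> 0 = 0"
    by (auto simp: orlicz_N_function_def)
  moreover from this(1) have "\<phi> ((1 - 1/2) *\<^sub>R y + (1/2) *\<^sub>R (- y)) \<le> (1 - 1/2) * \<phi> y + (1/2) * \<phi> (- y)"
    by (intro convex_onD) auto
  ultimately show ?thesis by simp
qed

text \<open>Superlinear growth makes \<open>x * y - \<phi> y\<close> nonpositive outside a bounded range of \<open>y\<close>. Every
  real supremum in the conjugate is therefore a true one.\<close>

lemma convex_conjugate_bdd_above: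
  assumes "orlicz_N_function \<phi>"
  shows "bdd_above (range (\<lambda>y. x * y - \<phi> y))"
proof -
  have even: "\<phi> \<bar>y\<bar> = \<phi> y" for y
    using assms by (auto simp: orlicz_N_function_def abs_real_def)
  have "filterlim (\<lambda>y. \<phi> y / y) at_top at_top"
    using assms by (simp add: orlicz_N_function_def)
  then have "eventually (\<lambda>y. \<bar>x\<bar> \<le> \<phi> y / y) at_top"
    by (simp add: filterlim_at_top)
  then obtain N0 where N0: "\<And>y. N0 \<le> y \<Longrightarrow> \<bar>x\<bar> \<le> \<phi> y / y"
    by (auto simp: eventually_at_top_linorder)
  define N where "N = max N0 1"
  have "x * y - \<phi> y \<le> \<bar>x\<bar> * N" for y
  proof (cases "\<bar>y\<bar> \<le> N")
    case True
    have "x * y \<le> \<bar>x\<bar> * \<bar>y\<bar>"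
      by (metis abs_ge_self abs_mult)
    also have "\<dots> \<le> \<bar>x\<bar> * N"
      using True by (simp add: mult_left_mono)
    finally show ?thesis
      using orlicz_N_function_nonneg[OF assms, of y] by linarith
  next
    case False
    then have "\<bar>x\<bar> \<le> \<phi> \<bar>y\<bar> / \<bar>y\<bar>" "0 < \<bar>y\<bar>"
      using N0 by (auto simp: N_def)
    then have "\<bar>x\<bar> * \<bar>y\<bar> \<le> \<phi> y"
      by (simp add: pos_le_divide_eq even)
    moreover have "x * y \<le> \<bar>x\<bar> * \<bar>y\<bar>"
      by (metis abs_ge_self abs_mult)
    moreover have "0 \<le> \<bar>x\<bar> * N"
      by (simp add: N_def)
    ultimately show ?thesis by linarith
  qed
  then show ?thesis by (auto intro!: bdd_aboveI)
qed

lemma convex_conjugate_upper: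
  assumes "orlicz_N_function \<phi>"
  shows "x * y - \<phi> y \<le> convex_conjugate \<phi> x"
  unfolding convex_conjugate_def
  using convex_conjugate_bdd_above[OF assms] by (intro cSUP_upper) auto

lemma convex_conjugate_least:
  "(\<And>y. x * y - \<phi> y \<le> C) \<Longrightarrow> convex_conjugate \<phi> x \<le> C"
  unfolding convex_conjugate_def by (intro cSUP_least) auto

lemma convex_conjugate_0:
  assumes "orlicz_N_function \<phi>"
  shows "convex_conjugate \<phi> 0 = 0"
proof (rule antisym)
  show "convex_conjugate \<phi> 0 \<le> 0"
    using orlicz_N_function_nonneg[OF assms] by (intro convex_conjugate_least) simp
  show "0 \<le> convex_conjugate \<phi> 0"
    using convex_conjugate_upper[OF assms, of 0 0] assms by (simp add: orlicz_N_function_def)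
qed

text \<open>The conjugate is a supremum of affine functions.\<close>

lemma convex_on_convex_conjugate:
  assumes "orlicz_N_function \<phi>"
  shows "convex_on UNIV (convex_conjugate \<phi>)"
proof (rule convex_onI)
  fix t x y :: real
  assume t: "0 < t" "t < 1"
  show "convex_conjugate \<phi> ((1 - t) *\<^sub>R x + t *\<^sub>R y)
          \<le> (1 - t) * convex_conjugate \<phi> x + t * convex_conjugate \<phi> y"
  proof (rule convex_conjugate_least)
    fix z
    have "((1 - t) *\<^sub>R x + t *\<^sub>R y) * z - \<phi> z = (1 - t) * (x * z - \<phi> z) + t * (y * z - \<phi> z)"
      by (simp add: algebra_simps)
    also have "\<dots> \<le> (1 - t) * convex_conjugate \<phi> x + t * convex_conjugate \<phi> y"
      using t by (intro add_mono mult_left_mono convex_conjugate_upper[OF assms]) auto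
    finally show "((1 - t) *\<^sub>R x + t *\<^sub>R y) * z - \<phi> z
        \<le> (1 - t) * convex_conjugate \<phi> x + t * convex_conjugate \<phi> y" .
  qed
qed simp

lemma convex_conjugate_scale:
  assumes "orlicz_N_function \<phi>" "0 \<le> t" "t \<le> 1"
  shows "convex_conjugate \<phi> (t * x) \<le> t * convex_conjugate \<phi> x"
  using convex_onD[OF convex_on_convex_conjugate[OF assms(1)], of t 0 x] assms
  by (simp add: convex_conjugate_0)

text \<open>Since \<open>\<phi> y / y\<close> tends to \<open>0\<close> at \<open>0\<close>, a small \<open>y > 0\<close> makes \<open>x * y - \<phi> y\<close> positive.\<close>

lemma convex_conjugate_pos:
  assumes "orlicz_N_function \<phi>" "0 < x"
  shows "0 < convex_conjugate \<phi> x"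
proof -
  have "((\<lambda>y. \<phi> y / y) \<longlongrightarrow> 0) (at_right 0)"
    using assms(1) by (auto simp: orlicz_N_function_def filterlim_at_split)
  then have "eventually (\<lambda>y. \<phi> y / y < x) (at_right 0)"
    using assms(2) by (rule order_tendstoD)
  then have "eventually (\<lambda>y. \<phi> y / y < x \<and> 0 < y) (at_right 0)"
    using eventually_at_right_less by (rule eventually_conj)
  then obtain y where "\<phi> y / y < x" "0 < y"
    using eventually_happens' by (metis (no_types, lifting) trivial_limit_at_right_real)
  then have "0 < x * y - \<phi> y"
    by (simp add: pos_divide_less_eq)
  also have "\<dots> \<le> convex_conjugate \<phi> x"
    by (rule convex_conjugate_upper[OF assms(1)])
  finally show ?thesis .
qed

lemma strict_mono_on_convex_conjugate:
  assumes "orlicz_N_function \<phi>"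
  shows "strict_mono_on {0..} (convex_conjugate \<phi>)"
proof (rule strict_mono_onI)
  fix x y :: real
  assume *: "x \<in> {0..}" "y \<in> {0..}" "x < y"
  have "convex_conjugate \<phi> x = convex_conjugate \<phi> (x / y * y)"
    using * by simp
  also have "\<dots> \<le> x / y * convex_conjugate \<phi> y"
    using * by (intro convex_conjugate_scale assms) auto
  also have "\<dots> < 1 * convex_conjugate \<phi> y"
    using * by (intro mult_strict_right_mono convex_conjugate_pos assms) auto
  finally show "convex_conjugate \<phi> x < convex_conjugate \<phi> y" by simp
qed

text \<open>The bound \<open>x - \<phi> 1\<close> from below makes the conjugate unbounded; a finite convex function on the
  line is continuous, so the intermediate value theorem gives surjectivity.\<close>

lemma convex_conjugate_surj:
  assumes "orlicz_N_function \<phi>" "0 \<le> z"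
  obtains x where "0 \<le> x" "convex_conjugate \<phi> x = z"
proof -
  have "continuous_on UNIV (convex_conjugate \<phi>)"
    by (intro convex_on_continuous convex_on_convex_conjugate assms) simp
  moreover have "z \<le> convex_conjugate \<phi> (z + \<phi> 1)"
    using convex_conjugate_upper[OF assms(1), of "z + \<phi> 1" 1] by simp
  ultimately have "\<exists>x. 0 \<le> x \<and> x \<le> z + \<phi> 1 \<and> convex_conjugate \<phi> x = z"
    using assms(2) orlicz_N_function_nonneg[OF assms(1), of 1]
    by (intro IVT') (auto simp: convex_conjugate_0[OF assms(1)] intro: continuous_on_subset)
  then show ?thesis using that by blast
qed

lemma conjugate_inv_convex_conjugate:
  assumes "orlicz_N_function \<phi>" "0 \<le> x"
  shows "conjugate_inv \<phi> (convex_conjugate \<phi> x) = x"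
  unfolding conjugate_inv_def
  using assms strict_mono_on_imp_inj_on[OF strict_mono_on_convex_conjugate[OF assms(1)]]
  by (intro the_inv_into_f_f) auto

lemma conjugate_inv_nonneg:
  assumes "orlicz_N_function \<phi>" "0 \<le> z"
  shows "0 \<le> conjugate_inv \<phi> z"
  by (metis assms convex_conjugate_surj conjugate_inv_convex_conjugate)

lemma conjugate_inv_double:
  assumes "orlicz_N_function \<phi>" "0 \<le> z"
  shows "conjugate_inv \<phi> (2 * z) \<le> 2 * conjugate_inv \<phi> z"
proof -
  obtain u where u: "0 \<le> u" "convex_conjugate \<phi> u = z"
    using convex_conjugate_surj[OF assms] by blast
  obtain v where v: "0 \<le> v" "convex_conjugate \<phi> v = 2 * z"
    using convex_conjugate_surj[OF assms(1), of "2 * z"] assms(2) by auto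
  have "convex_conjugate \<phi> v \<le> convex_conjugate \<phi> (2 * u)"
    using convex_conjugate_scale[OF assms(1), of "1/2" "2 * u"] u v by simp
  then have "v \<le> 2 * u"
    using strict_mono_on_leD[OF strict_mono_on_convex_conjugate[OF assms(1)]]
      strict_mono_onD[OF strict_mono_on_convex_conjugate[OF assms(1)], of "2 * u" v] u v
    by force
  then show ?thesis
    using conjugate_inv_convex_conjugate[OF assms(1) u(1)]
      conjugate_inv_convex_conjugate[OF assms(1) v(1)] u(2) v(2) by simp
qed

section \<open>Suprema of series\<close>

lemma suminf_ennreal_add_le:
  fixes f g :: "nat \<Rightarrow> ennreal"
  assumes "\<And>i. g i \<le> f i" and "g j + e \<le> f j"
  shows "e + (\<Sum>i. g i) \<le> (\<Sum>i. f i)"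
proof -
  have "(\<Sum>i. if i = j then e else 0) = e"
    by (subst suminf_finite[of "{j}"]) auto
  then have "e + (\<Sum>i. g i) = (\<Sum>i. (if i = j then e else 0) + g i)"
    by (subst suminf_add[symmetric]) auto
  also have "\<dots> \<le> (\<Sum>i. f i)"
    using assms by (intro suminf_le) (auto simp: add.commute)
  finally show ?thesis .
qed

text \<open>How a gain at the single level \<open>j\<close> becomes a gain for the functional: because \<open>b\<close> is the same
  for all points of \<open>K\<close>, the constant \<open>w j * b\<close> can be pulled out of the supremum.\<close>

lemma SUP_weighted_suminf_add_le:
  fixes D E :: "'a \<Rightarrow> nat \<Rightarrow> ennreal" and w :: "nat \<Rightarrow> real"
  assumes "K \<subseteq> K'" "K \<noteq> {}"
    and "\<And>t i. t \<in> K \<Longrightarrow> E t i \<le> D t i"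
    and "\<And>t. t \<in> K \<Longrightarrow> E t j + ennreal b \<le> D t j"
    and "0 \<le> w j" "0 \<le> b" "g \<le> w j * b"
  shows "ennreal g + (SUP t\<in>K. \<Sum>i. ennreal (w i) * E t i)
           \<le> (SUP t\<in>K'. \<Sum>i. ennreal (w i) * D t i)"
proof -
  have "ennreal g + (\<Sum>i. ennreal (w i) * E t i) \<le> (\<Sum>i. ennreal (w i) * D t i)"
    if t: "t \<in> K" for t
  proof (rule suminf_ennreal_add_le)
    show "ennreal (w i) * E t i \<le> ennreal (w i) * D t i" for i
      using assms(3) t by (simp add: mult_left_mono)
    have "ennreal (w j) * E t j + ennreal g \<le> ennreal (w j) * E t j + ennreal (w j) * ennreal b"
      using assms by (intro add_left_mono) (simp add: ennreal_mult[symmetric] ennreal_leI)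
    also have "\<dots> = ennreal (w j) * (E t j + ennreal b)"
      by (simp add: distrib_left)
    also have "\<dots> \<le> ennreal (w j) * D t j"
      using assms(4)[OF t] by (simp add: mult_left_mono)
    finally show "ennreal (w j) * E t j + ennreal g \<le> ennreal (w j) * D t j" .
  qed
  then have "(SUP t\<in>K. ennreal g + (\<Sum>i. ennreal (w i) * E t i))
      \<le> (SUP t\<in>K'. \<Sum>i. ennreal (w i) * D t i)"
    using assms(1) by (intro SUP_mono) blast
  then show ?thesis
    using assms(2) by (simp add: ennreal_SUP_add_right)
qed

section \<open>Restricting partitions\<close>

lemma block_eq:
  assumes "partition_on H P" "B \<in> P" "t \<in> B"
  shows "block P t = B"
  unfolding block_def
  using assms by (intro the_equality) (auto simp: partition_on_def disjoint_def)

lemma block_mem: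
  assumes "partition_on H P" "t \<in> H"
  shows "block P t \<in> P" "t \<in> block P t" "block P t \<subseteq> H"
proof -
  obtain B where "B \<in> P" "t \<in> B"
    using assms by (auto simp: partition_on_def)
  then show "block P t \<in> P" "t \<in> block P t" "block P t \<subseteq> H"
    using block_eq[OF assms(1)] partition_onD1[OF assms(1)] by auto
qed

definition restrict_partition :: "'a set \<Rightarrow> 'a set set \<Rightarrow> 'a set set" where
  "restrict_partition K P = (\<inter>) K ` P - {{}}"

lemma partition_on_restrict_partition:
  assumes "partition_on H P" "K \<subseteq> H"
  shows "partition_on K (restrict_partition K P)"
  using partition_on_restrict[OF assms(1), of K] assms(2)
  by (simp add: restrict_partition_def Int_absorb2)

lemma block_restrict_partition:
  assumes "partition_on H P" "K \<subseteq> H" "t \<in> K"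
  shows "block (restrict_partition K P) t = K \<inter> block P t"
proof (rule block_eq)
  show "partition_on K (restrict_partition K P)"
    using assms(1,2) by (rule partition_on_restrict_partition)
  show "K \<inter> block P t \<in> restrict_partition K P" "t \<in> K \<inter> block P t"
    using block_mem[OF assms(1), of t] assms by (auto simp: restrict_partition_def)
qed

lemma card_restrict_partition_le:
  assumes "finite P"
  shows "finite (restrict_partition K P)" "card (restrict_partition K P) \<le> card P"
proof -
  show "finite (restrict_partition K P)"
    using assms by (simp add: restrict_partition_def)
  have "card (restrict_partition K P) \<le> card ((\<inter>) K ` P)"
    unfolding restrict_partition_def using assms by (intro card_mono) auto
  also have "\<dots> \<le> card P"
    using assms by (rule card_image_le)
  finally show "card (restrict_partition K P) \<le> card P" .
qed

lemma refines_restrict_partition: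
  assumes "refines H P Q" "K \<subseteq> H"
  shows "refines K (restrict_partition K P) (restrict_partition K Q)"
proof -
  have "\<exists>Y\<in>restrict_partition K Q. X \<subseteq> Y" if "X \<in> restrict_partition K P" for X
  proof -
    from that obtain X' where X': "X' \<in> P" "X = K \<inter> X'" "X \<noteq> {}"
      by (auto simp: restrict_partition_def)
    then obtain Y' where "Y' \<in> Q" "X' \<subseteq> Y'"
      using assms(1) by (auto simp: refines_def)
    with X' have "K \<inter> Y' \<in> restrict_partition K Q" "X \<subseteq> K \<inter> Y'"
      by (auto simp: restrict_partition_def)
    then show ?thesis by blast
  qed
  then show ?thesis
    using assms by (auto simp: refines_def partition_on_restrict_partition)
qed

lemma admissible_sequence_card:
  assumes "admissible_sequence H A"
  shows "finite (A n)" "card (A n) \<le> 2 ^ 2 ^ n"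
proof -
  have "finite (A n) \<and> card (A n) \<le> 2 ^ 2 ^ n"
  proof (cases n)
    case 0
    then show ?thesis
      using assms by (auto simp: admissible_sequence_def intro: card_ge_0_finite)
  next
    case (Suc k)
    then show ?thesis
      using assms by (auto simp: admissible_sequence_def)
  qed
  then show "finite (A n)" "card (A n) \<le> 2 ^ 2 ^ n" by auto
qed

lemma admissible_sequence_restrict:
  assumes "admissible_sequence H A" "K \<subseteq> H" "K \<noteq> {}"
  shows "admissible_sequence K (\<lambda>n. restrict_partition K (A n))"
proof -
  note card_A = admissible_sequence_card[OF assms(1)]
  have part: "partition_on K (restrict_partition K (A n))" for n
    using assms by (intro partition_on_restrict_partition) (auto simp: admissible_sequence_def)
  have "card (restrict_partition K (A 0)) \<le> 1"
    using card_restrict_partition_le(2)[OF card_A(1), of K 0] assms(1)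
    by (simp add: admissible_sequence_def)
  moreover have "restrict_partition K (A 0) \<noteq> {}"
    using part[of 0] assms(3) by (auto simp: partition_on_def)
  then have "card (restrict_partition K (A 0)) \<noteq> 0"
    using card_restrict_partition_le(1)[OF card_A(1)] by simp
  ultimately have "card (restrict_partition K (A 0)) = 1" by linarith
  moreover have "card (restrict_partition K (A n)) \<le> 2 ^ 2 ^ n" for n
    using card_restrict_partition_le(2)[OF card_A(1)] card_A(2) by (rule order_trans)
  ultimately show ?thesis
    using assms part card_restrict_partition_le(1)[OF card_A(1)]
    by (auto simp: admissible_sequence_def intro: refines_restrict_partition)
qed

section \<open>Monotonicity of the functionals\<close>

lemma ext_diameter_mono: "S \<subseteq> S' \<Longrightarrow> ext_diameter d S \<le> ext_diameter d S'"
  unfolding ext_diameter_def by (intro SUP_subset_mono) auto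

text \<open>Restricting an admissible sequence to a nonempty subset shrinks every block.\<close>

lemma set_functional_gamma_fun: "set_functional T (gamma_fun \<phi> p d)"
  unfolding set_functional_def
proof (intro allI impI)
  fix K H assume KH: "K \<subseteq> H \<and> H \<subseteq> T"
  show "gamma_fun \<phi> p d K \<le> gamma_fun \<phi> p d H"
  proof (cases "K = {}")
    case True
    then show ?thesis by (simp add: gamma_fun_def)
  next
    case False
    let ?c = "\<lambda>n. conjugate_inv \<phi> (2 ^ (n + k_index p))"
    let ?A = "\<lambda>A n. restrict_partition K (A n)"
    have "(INF A\<in>{A. admissible_sequence K A}. SUP t\<in>K.
              \<Sum>n. ennreal (?c n) * ext_diameter d (block (A (n + k_index p)) t))
        \<le> (INF A\<in>{A. admissible_sequence H A}. SUP t\<in>H.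
              \<Sum>n. ennreal (?c n) * ext_diameter d (block (A (n + k_index p)) t))"
    proof (rule INF_mono)
      fix A assume "A \<in> {A. admissible_sequence H A}"
      then have A: "admissible_sequence H A" by simp
      then have part: "partition_on H (A i)" for i
        by (simp add: admissible_sequence_def)
      have "(SUP t\<in>K. \<Sum>n. ennreal (?c n) * ext_diameter d (block (?A A (n + k_index p)) t))
          \<le> (SUP t\<in>H. \<Sum>n. ennreal (?c n) * ext_diameter d (block (A (n + k_index p)) t))"
      proof (rule SUP_subset_mono)
        fix t assume "t \<in> K"
        then have "block (?A A i) t \<subseteq> block (A i) t" for i
          using block_restrict_partition[OF part] KH by blast
        then show "(\<Sum>n. ennreal (?c n) * ext_diameter d (block (?A A (n + k_index p)) t))
            \<le> (\<Sum>n. ennreal (?c n) * ext_diameter d (block (A (n + k_index p)) t))"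
          by (intro suminf_le mult_left_mono ext_diameter_mono) auto
      qed (use KH in auto)
      then show "\<exists>B\<in>{A. admissible_sequence K A}.
          (SUP t\<in>K. \<Sum>n. ennreal (?c n) * ext_diameter d (block (B (n + k_index p)) t))
          \<le> (SUP t\<in>H. \<Sum>n. ennreal (?c n) * ext_diameter d (block (A (n + k_index p)) t))"
        using admissible_sequence_restrict[OF A] KH False
        by (intro bexI[where x = "?A A"]) auto
    qed
    then show ?thesis
      using False KH by (auto simp: gamma_fun_def)
  qed
qed

lemma set_functional_gamma_tilde: "set_functional T (gamma_tilde \<phi> p T d)"
  unfolding set_functional_def gamma_tilde_def
  by (intro allI impI INF_superset_mono SUP_subset_mono) auto

section \<open>Pigeonhole for separated sets\<close>

lemma card_level_less:
  fixes c :: nat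
  assumes "c \<le> 2 ^ 2 ^ (n - 1)" "1 \<le> n"
  shows "c < 2 ^ 2 ^ n"
proof -
  have "(2::nat) ^ 2 ^ (n - 1) < 2 ^ 2 ^ n"
    using assms(2) by (intro power_strict_increasing) auto
  with assms(1) show ?thesis by linarith
qed

context Metric_space
begin

text \<open>Since \<open>r \<ge> 16\<close>, the radius \<open>2 * a / r\<close> of the pieces is at most \<open>a / 8\<close>.\<close>

lemma separated_setsE:
  assumes "separated_sets M d a r m H" "16 \<le> r" "0 < a"
  obtains t where "\<And>l. l \<in> {1..m} \<Longrightarrow> t l \<in> M"
    and "\<And>l. l \<in> {1..m} \<Longrightarrow> H l \<noteq> {} \<and> H l \<subseteq> M"
    and "\<And>l l'. l \<in> {1..m} \<Longrightarrow> l' \<in> {1..m} \<Longrightarrow> l \<noteq> l' \<Longrightarrow> a \<le> d (t l) (t l')"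
    and "\<And>l x. l \<in> {1..m} \<Longrightarrow> x \<in> H l \<Longrightarrow> d (t l) x \<le> a / 8"
proof -
  from assms(1) obtain t where t: "\<forall>l\<in>{1..m}. t l \<in> M"
    "\<forall>l\<in>{1..m}. \<forall>l'\<in>{1..m}. l \<noteq> l' \<longrightarrow> a \<le> d (t l) (t l')"
    "\<forall>l\<in>{1..m}. H l \<subseteq> mcball (t l) (2 * a / real r)"
    unfolding separated_sets_def by blast
  have "2 * a / real r \<le> 2 * a / 16"
    using assms by (intro divide_left_mono) auto
  then have "d (t l) x \<le> a / 8" if "l \<in> {1..m}" "x \<in> H l" for l x
    using t(3) that by (force simp: mcball_def)
  then show ?thesis
    using that[of t] t assms(1) by (auto simp: separated_sets_def)
qed

lemma separated_sets_far:
  assumes "separated_sets M d a r m H" "16 \<le> r" "0 < a"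
    and "l \<in> {1..m}" "l' \<in> {1..m}" "l \<noteq> l'" "x \<in> H l" "y \<in> H l'"
  shows "3 * a / 4 \<le> d x y"
proof -
  obtain t where t: "\<And>l. l \<in> {1..m} \<Longrightarrow> t l \<in> M"
    "\<And>l. l \<in> {1..m} \<Longrightarrow> H l \<noteq> {} \<and> H l \<subseteq> M"
    "\<And>l l'. l \<in> {1..m} \<Longrightarrow> l' \<in> {1..m} \<Longrightarrow> l \<noteq> l' \<Longrightarrow> a \<le> d (t l) (t l')"
    "\<And>l x. l \<in> {1..m} \<Longrightarrow> x \<in> H l \<Longrightarrow> d (t l) x \<le> a / 8"
    using separated_setsE[OF assms(1-3)] by metis
  have mem: "t l \<in> M" "t l' \<in> M" "x \<in> M" "y \<in> M"
    using t(1,2) assms by blast+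
  have "d (t l) (t l') \<le> d (t l) x + d x (t l')" "d x (t l') \<le> d x y + d (t l') y"
    using mem triangle[of "t l" x "t l'"] triangle[of x y "t l'"] by (simp_all add: commute)
  moreover have "a \<le> d (t l) (t l')" "d (t l) x \<le> a / 8" "d (t l') y \<le> a / 8"
    using t assms by auto
  ultimately show ?thesis by linarith
qed

lemma separated_sets_diameter:
  assumes "separated_sets M d a r m H" "16 \<le> r" "0 < a" "l \<in> {1..m}"
  shows "ext_diameter d (H l) \<le> ennreal (a / 4)"
proof -
  obtain t where t: "t l \<in> M" "H l \<subseteq> M" "\<And>x. x \<in> H l \<Longrightarrow> d (t l) x \<le> a / 8"
    using separated_setsE[OF assms(1-3)] assms(4) by metis
  have "d x y \<le> a / 4" if "x \<in> H l" "y \<in> H l" for x y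
  proof -
    have "d x y \<le> d (t l) x + d (t l) y"
      using t that triangle[of x "t l" y] by (auto simp: commute)
    then show ?thesis
      using t(3)[OF that(1)] t(3)[OF that(2)] by linarith
  qed
  then show ?thesis
    unfolding ext_diameter_def by (intro SUP_least ennreal_leI) auto
qed

text \<open>If every piece contained a whole block, then, the pieces being disjoint, these blocks would
  be distinct, and there would be at least \<open>m\<close> of them.\<close>

lemma separated_pieces_unresolved:
  assumes "separated_sets M d a r m H" "16 \<le> r" "0 < a"
    and P: "partition_on (\<Union>l\<in>{1..m}. H l) P" "finite P" "card P < m"
  obtains l where "l \<in> {1..m}" "\<And>x. x \<in> H l \<Longrightarrow> \<not> block P x \<subseteq> H l"
proof -
  have "\<exists>l\<in>{1..m}. \<forall>x\<in>H l. \<not> block P x \<subseteq> H l"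
  proof (rule ccontr)
    assume "\<not> ?thesis"
    then obtain x where x: "\<And>l. l \<in> {1..m} \<Longrightarrow> x l \<in> H l \<and> block P (x l) \<subseteq> H l"
      by metis
    have x_block: "block P (x l) \<in> P \<and> x l \<in> block P (x l)" if "l \<in> {1..m}" for l
      using block_mem[OF P(1), of "x l"] x that by blast
    have inj: "inj_on (\<lambda>l. block P (x l)) {1..m}"
    proof (rule inj_onI, rule ccontr)
      fix l l' assume l: "l \<in> {1..m}" "l' \<in> {1..m}" "block P (x l) = block P (x l')" "l \<noteq> l'"
      then have "x l \<in> H l" "x l \<in> H l'"
        using x x_block by blast+
      then have "3 * a / 4 \<le> d (x l) (x l)"
        using separated_sets_far[OF assms(1-3)] l by blast
      moreover have "x l \<in> M"
        using l \<open>x l \<in> H l\<close> assms(1) by (auto simp: separated_sets_def)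
      ultimately show False
        using assms(3) by simp
    qed
    have "card {1..m} \<le> card P"
      using x_block by (intro card_inj_on_le[OF inj]) (auto simp: P(2))
    with P(3) show False by simp
  qed
  then show ?thesis using that by blast
qed

text \<open>A point at distance less than \<open>a / 2\<close> from one centre is not that close to another, so fewer
  than \<open>m\<close> points cannot come that close to all \<open>m\<close> centres.\<close>

lemma separated_centres_unapproximated:
  fixes t :: "nat \<Rightarrow> 'a"
  assumes t: "\<And>l. l \<in> {1..m} \<Longrightarrow> t l \<in> M"
    and sep: "\<And>l l'. l \<in> {1..m} \<Longrightarrow> l' \<in> {1..m} \<Longrightarrow> l \<noteq> l' \<Longrightarrow> a \<le> d (t l) (t l')"
    and S: "S \<subseteq> M" "finite S" "card S < m"
  obtains l where "l \<in> {1..m}" "\<And>s. s \<in> S \<Longrightarrow> a / 2 \<le> d (t l) s"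
proof -
  have "\<exists>l\<in>{1..m}. \<forall>s\<in>S. a / 2 \<le> d (t l) s"
  proof (rule ccontr)
    assume "\<not> ?thesis"
    then obtain s where s: "\<And>l. l \<in> {1..m} \<Longrightarrow> s l \<in> S \<and> d (t l) (s l) < a / 2"
      by (metis not_le)
    have inj: "inj_on s {1..m}"
    proof (rule inj_onI, rule ccontr)
      fix l l' assume l: "l \<in> {1..m}" "l' \<in> {1..m}" "s l = s l'" "l \<noteq> l'"
      have "d (t l) (t l') \<le> d (t l) (s l) + d (t l') (s l)"
        using t s l S(1) triangle[of "t l" "s l" "t l'"] by (auto simp: commute)
      also have "\<dots> < a"
        using s[OF l(1)] s[OF l(2)] l(3) by auto
      finally show False
        using sep l by force
    qed
    have "card {1..m} \<le> card S"
      using s by (intro card_inj_on_le[OF inj]) (auto simp: S(2))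
    with S(3) show False by simp
  qed
  then show ?thesis using that by blast
qed

section \<open>The growth inequalities\<close>

text \<open>A block that leaves \<open>H l\<close> has diameter at least \<open>3 * a / 4\<close>, its trace on \<open>H l\<close> at most
  \<open>a / 4\<close>. The difference \<open>a / 2\<close> exceeds the \<open>a / 4\<close> that the constant \<open>1 / 8\<close> asks for.\<close>

lemma gamma_fun_growth:
  assumes \<phi>: "orlicz_N_function \<phi>"
    and n: "1 + k_index p \<le> n" and r: "16 \<le> r" and a: "0 < a"
    and sep: "separated_sets M d a r (2 ^ 2 ^ n) H"
  shows "ennreal (1 / 8 * a * conjugate_inv \<phi> (2 ^ n))
           + Min ((\<lambda>l. gamma_fun \<phi> p d (H l)) ` {1..2 ^ 2 ^ n})
         \<le> gamma_fun \<phi> p d (\<Union>l\<in>{1..2 ^ 2 ^ n}. H l)"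
proof -
  define m :: nat where "m = 2 ^ 2 ^ n"
  note sep = sep[folded m_def]
  define U where "U = (\<Union>l\<in>{1..m}. H l)"
  define c where "c i = conjugate_inv \<phi> (2 ^ (i + k_index p))" for i
  define j where "j = n - 1 - k_index p"
  \<comment> \<open>The sums are shifted to start at \<open>k_index p\<close>; their term \<open>j\<close> is the one of level \<open>n - 1\<close>.\<close>
  have j: "j + k_index p = n - 1"
    using n by (simp add: j_def)
  have c_j: "0 \<le> c j" "conjugate_inv \<phi> (2 ^ n) \<le> 2 * c j"
    using conjugate_inv_nonneg[OF \<phi>, of "2 ^ (n - 1)"]
      conjugate_inv_double[OF \<phi>, of "2 ^ (n - 1)"] n
    by (simp_all add: c_def j power_Suc[symmetric] del: power_Suc)
  let ?V = "\<lambda>K A. SUP t\<in>K. \<Sum>i. ennreal (c i) * ext_diameter d (block (A (i + k_index p)) t)"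
  let ?g = "1 / 8 * a * conjugate_inv \<phi> (2 ^ n)"
  have "ennreal ?g + Min ((\<lambda>l. gamma_fun \<phi> p d (H l)) ` {1..m}) \<le> ?V U A"
    if A: "admissible_sequence U A" for A
  proof -
    have part: "partition_on U (A i)" for i
      using A by (simp add: admissible_sequence_def)
    \<comment> \<open>Level \<open>n - 1\<close> is the finest one at which the partition still has fewer than \<open>m\<close> blocks for sure.\<close>
    have "card (A (n - 1)) < m"
      using admissible_sequence_card(2)[OF A] n unfolding m_def by (intro card_level_less) auto
    then obtain l where l: "l \<in> {1..m}" "\<And>x. x \<in> H l \<Longrightarrow> \<not> block (A (n - 1)) x \<subseteq> H l"
      using separated_pieces_unresolved[OF sep r a] part admissible_sequence_card(1)[OF A]
      unfolding U_def by metis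
    have HU: "H l \<subseteq> U" and H: "H l \<noteq> {}"
      using l sep by (auto simp: U_def separated_sets_def)
    have block_eq_Int: "block (restrict_partition (H l) (A i)) t = H l \<inter> block (A i) t"
      if "t \<in> H l" for i t
      using block_restrict_partition[OF part HU that] .
    have gain: "ext_diameter d (H l \<inter> block (A (n - 1)) t) + ennreal (a / 4)
          \<le> ext_diameter d (block (A (n - 1)) t)" if t: "t \<in> H l" for t
    proof -
      note B = block_mem[OF part subsetD[OF HU t], of "n - 1"]
      obtain y where y: "y \<in> block (A (n - 1)) t" "y \<notin> H l"
        using l(2)[OF t] by blast
      then obtain l' where l': "l' \<in> {1..m}" "y \<in> H l'" "l' \<noteq> l"
        using B(3) unfolding U_def by blast
      have "ext_diameter d (H l \<inter> block (A (n - 1)) t) \<le> ennreal (a / 4)"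
        using ext_diameter_mono separated_sets_diameter[OF sep r a l(1)]
        by (meson Int_lower1 order_trans)
      then have "ext_diameter d (H l \<inter> block (A (n - 1)) t) + ennreal (a / 4)
          \<le> ennreal (a / 4) + ennreal (a / 4)"
        by (rule add_right_mono)
      also have "\<dots> \<le> ennreal (3 * a / 4)"
        using a by (simp add: ennreal_plus[symmetric] ennreal_leI del: ennreal_plus)
      also have "\<dots> \<le> ennreal (d t y)"
        using separated_sets_far[OF sep r a l(1) l'(1) _ t l'(2)] l'(3) by (intro ennreal_leI) auto
      also have "\<dots> \<le> ext_diameter d (block (A (n - 1)) t)"
        unfolding ext_diameter_def using B(2) y(1) by (meson SUP_upper2 order_refl)
      finally show ?thesis .
    qed
    have "Min ((\<lambda>l. gamma_fun \<phi> p d (H l)) ` {1..m}) \<le> gamma_fun \<phi> p d (H l)"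
      using l(1) by (intro Min_le) auto
    also have "\<dots> \<le> ?V (H l) (\<lambda>i. restrict_partition (H l) (A i))"
      using H admissible_sequence_restrict[OF A HU H]
      by (auto simp: gamma_fun_def c_def intro: INF_lower)
    finally have "ennreal ?g + Min ((\<lambda>l. gamma_fun \<phi> p d (H l)) ` {1..m})
        \<le> ennreal ?g + ?V (H l) (\<lambda>i. restrict_partition (H l) (A i))"
      by (rule add_left_mono)
    also have "\<dots> \<le> ?V U A"
    proof (rule SUP_weighted_suminf_add_le[where j = j and b = "a / 4"])
      show "ext_diameter d (block (restrict_partition (H l) (A (i + k_index p))) t)
          \<le> ext_diameter d (block (A (i + k_index p)) t)" if "t \<in> H l" for t i
        using block_eq_Int[OF that] by (simp add: ext_diameter_mono)
      show "ext_diameter d (block (restrict_partition (H l) (A (j + k_index p))) t) + ennreal (a / 4)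
          \<le> ext_diameter d (block (A (j + k_index p)) t)" if "t \<in> H l" for t
        using gain[OF that] block_eq_Int[OF that] by (simp add: j)
      show "?g \<le> c j * (a / 4)"
        using mult_left_mono[OF c_j(2), of a] a by (simp add: algebra_simps)
    qed (use HU H a c_j in auto)
    finally show ?thesis .
  qed
  moreover have "H 1 \<noteq> {}" "1 \<in> {1..m}"
    using sep by (auto simp: separated_sets_def m_def)
  then have "U \<noteq> {}" by (auto simp: U_def)
  ultimately have "ennreal ?g + Min ((\<lambda>l. gamma_fun \<phi> p d (H l)) ` {1..m}) \<le> gamma_fun \<phi> p d U"
    by (auto simp: gamma_fun_def[of _ _ _ U] c_def[symmetric] intro!: INF_greatest)
  then show ?thesis
    by (simp only: U_def m_def)
qed

text \<open>Here the gain is \<open>3 * a / 8 - a / 8 = a / 4\<close>, exactly what the constant \<open>1 / 8\<close> asks for.\<close>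

lemma gamma_tilde_growth:
  assumes \<phi>: "orlicz_N_function \<phi>"
    and n: "1 + k_index p \<le> n" and r: "16 \<le> r" and a: "0 < a"
    and sep: "separated_sets M d a r (2 ^ 2 ^ n) H"
  shows "ennreal (1 / 8 * a * conjugate_inv \<phi> (2 ^ n))
           + Min ((\<lambda>l. gamma_tilde \<phi> p M d (H l)) ` {1..2 ^ 2 ^ n})
         \<le> gamma_tilde \<phi> p M d (\<Union>l\<in>{1..2 ^ 2 ^ n}. H l)"
proof -
  define m :: nat where "m = 2 ^ 2 ^ n"
  note sep = sep[folded m_def]
  define U where "U = (\<Union>l\<in>{1..m}. H l)"
  define c where "c i = conjugate_inv \<phi> (2 ^ (i + k_index p))" for i
  define j where "j = n - 1 - k_index p"
  \<comment> \<open>The sums are shifted to start at \<open>k_index p\<close>; their term \<open>j\<close> is the one of level \<open>n - 1\<close>.\<close>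
  have j: "i + k_index p = n - 1 \<longleftrightarrow> i = j" for i
    using n by (auto simp: j_def)
  have c_j: "0 \<le> c j" "conjugate_inv \<phi> (2 ^ n) \<le> 2 * c j"
    using conjugate_inv_nonneg[OF \<phi>, of "2 ^ (n - 1)"]
      conjugate_inv_double[OF \<phi>, of "2 ^ (n - 1)"] n j[of j]
    by (simp_all add: c_def power_Suc[symmetric] del: power_Suc)
  obtain t where t: "\<And>l. l \<in> {1..m} \<Longrightarrow> t l \<in> M"
    "\<And>l. l \<in> {1..m} \<Longrightarrow> H l \<noteq> {} \<and> H l \<subseteq> M"
    "\<And>l l'. l \<in> {1..m} \<Longrightarrow> l' \<in> {1..m} \<Longrightarrow> l \<noteq> l' \<Longrightarrow> a \<le> d (t l) (t l')"
    "\<And>l x. l \<in> {1..m} \<Longrightarrow> x \<in> H l \<Longrightarrow> d (t l) x \<le> a / 8"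
    using separated_setsE[OF sep r a] by metis
  let ?S = "{S :: nat \<Rightarrow> 'a set. \<forall>n. S n \<subseteq> M \<and> finite (S n) \<and> card (S n) \<le> 2 ^ 2 ^ n}"
  let ?V = "\<lambda>K S. SUP t\<in>K. \<Sum>i. ennreal (c i) * ext_dist_to d t (S (i + k_index p))"
  let ?g = "1 / 8 * a * conjugate_inv \<phi> (2 ^ n)"
  have "ennreal ?g + Min ((\<lambda>l. gamma_tilde \<phi> p M d (H l)) ` {1..m}) \<le> ?V U S"
    if S: "S \<in> ?S" for S
  proof -
    have "card (S (n - 1)) < m"
      using S n unfolding m_def by (intro card_level_less) auto
    then obtain l where l: "l \<in> {1..m}" "\<And>s. s \<in> S (n - 1) \<Longrightarrow> a / 2 \<le> d (t l) s"
      using separated_centres_unapproximated[of m t a "S (n - 1)"] t(1,3) S by auto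
    \<comment> \<open>The centre \<open>t l\<close> approximates all of \<open>H l\<close> to within \<open>a / 8\<close>, so one point is enough at this level.\<close>
    define S' where "S' = S(n - 1 := {t l})"
    have S': "S' \<in> ?S"
      using S t(1)[OF l(1)] by (auto simp: S'_def)
    have gain: "ext_dist_to d x (S' (n - 1)) + ennreal (a / 4) \<le> ext_dist_to d x (S (n - 1))"
      if x: "x \<in> H l" for x
    proof -
      have xt: "d (t l) x \<le> a / 8" "x \<in> M" "t l \<in> M"
        using t l(1) x by auto
      have "ext_dist_to d x (S' (n - 1)) + ennreal (a / 4) = ennreal (d x (t l)) + ennreal (a / 4)"
        by (simp add: S'_def ext_dist_to_def)
      also have "\<dots> = ennreal (d x (t l) + a / 4)"
        using a by (intro ennreal_plus[symmetric]) auto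
      also have "\<dots> \<le> ext_dist_to d x (S (n - 1))"
        unfolding ext_dist_to_def
      proof (intro INF_greatest ennreal_leI)
        fix s assume s: "s \<in> S (n - 1)"
        then have "s \<in> M" using S by auto
        then have "d (t l) s \<le> d (t l) x + d x s"
          using xt by (intro triangle)
        then show "d x (t l) + a / 4 \<le> d x s"
          using l(2)[OF s] xt by (simp add: commute[of x "t l"])
      qed
      finally show ?thesis .
    qed
    have "Min ((\<lambda>l. gamma_tilde \<phi> p M d (H l)) ` {1..m}) \<le> gamma_tilde \<phi> p M d (H l)"
      using l(1) by (intro Min_le) auto
    also have "\<dots> \<le> ?V (H l) S'"
      unfolding gamma_tilde_def c_def using S' by (rule INF_lower)
    finally have "ennreal ?g + Min ((\<lambda>l. gamma_tilde \<phi> p M d (H l)) ` {1..m})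
        \<le> ennreal ?g + ?V (H l) S'"
      by (rule add_left_mono)
    also have "\<dots> \<le> ?V U S"
    proof (rule SUP_weighted_suminf_add_le[where j = j and b = "a / 4"])
      show gain_j: "ext_dist_to d x (S' (j + k_index p)) + ennreal (a / 4)
          \<le> ext_dist_to d x (S (j + k_index p))" if "x \<in> H l" for x
        using gain[OF that] j[of j] by simp
      show "ext_dist_to d x (S' (i + k_index p)) \<le> ext_dist_to d x (S (i + k_index p))"
        if "x \<in> H l" for x i
      proof (cases "i = j")
        case True
        then show ?thesis
          using order_trans[OF _ gain_j[OF that]] by simp
      next
        case False
        then show ?thesis
          using j[of i] by (simp add: S'_def)
      qed
      show "?g \<le> c j * (a / 4)"
        using mult_left_mono[OF c_j(2), of a] a by (simp add: algebra_simps)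
    qed (use l t(2) a c_j in \<open>auto simp: U_def\<close>)
    finally show ?thesis .
  qed
  then have "ennreal ?g + Min ((\<lambda>l. gamma_tilde \<phi> p M d (H l)) ` {1..m}) \<le> gamma_tilde \<phi> p M d U"
    unfolding gamma_tilde_def[of _ _ _ _ U] c_def[symmetric] by (intro INF_greatest)
  then show ?thesis
    by (simp only: U_def m_def)
qed

end

theorem proposition3p11:
  fixes \<phi> :: "real \<Rightarrow> real" and M :: "'w measure" and T :: "'t set"
    and X :: "'t \<Rightarrow> 'w \<Rightarrow> real" and d :: "'t \<Rightarrow> 't \<Rightarrow> real" and p :: real and r :: nat
  assumes "orlicz_N_function \<phi>"
    and "Q_condition \<phi>"
    and "prob_space M"
    and "sub_gaussian_process M \<phi> T X"
    and "Metric_space T d"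
    and "\<forall>s\<in>T. \<forall>t\<in>T. d s t = sub_gaussian_norm M \<phi> (\<lambda>w. X t w - X s w)"
    and "1 \<le> p"
    and "16 \<le> r"
  shows "generalized_growth_condition \<phi> p T d r (1 / 8) (gamma_fun \<phi> p d) \<and>
         generalized_growth_condition \<phi> p T d r (1 / 8) (gamma_tilde \<phi> p T d)"
proof -
  interpret Metric_space T d by fact
  have "8 \<le> r" "(0::real) < 1 / 8"
    using assms(8) by simp_all
  then show ?thesis
    unfolding generalized_growth_condition_def
    using set_functional_gamma_fun[of T \<phi> p d] set_functional_gamma_tilde[of T \<phi> p d]
      gamma_fun_growth[OF assms(1) _ assms(8)] gamma_tilde_growth[OF assms(1) _ assms(8)]
    by blast
qed

end
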